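(* Let $\mathcal{M}=\mathcal{HG}(3)\times\mathbb{R}^6\times\mathbb{R}^3$ with elements $\xi=(\mathbf{T},\boldsymbol{b},\boldsymbol{p})$, and let $\mathbf{G_{DP}}=\mathbf{HG}(3)\ltimes\mathfrak{hg}(3)\times\mathbb{R}^3$ with elements $X=(B,\beta,c)$, $B\in\mathbf{HG}(3)$, $\beta\in\mathfrak{hg}(3)$, $c\in\mathbb{R}^3$. Define $\phi:\mathbf{G_{DP}}\times\mathcal{M}\to\mathcal{M}$ by $$\phi(X,\xi):=\big(\mathbf{T}B,\;\mathbf{Ad}^{\vee}_{B^{-1}}(\boldsymbol{b}-\beta^{\vee}),\;\boldsymbol{p}+c\big).$$ Then $\phi$ is a transitive right group action of $\mathbf{G_{DP}}$ on $\mathcal{M}$.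
   Context: $\mathbf{HG}(3)$ (the homogeneous Galilean group) is the matrix Lie group of $4\times4$ matrices $\begin{bmatrix}A&\boldsymbol{a}\\0&1\end{bmatrix}$ with $A\in\mathbf{SO}(3)$, $\boldsymbol{a}\in\mathbb{R}^3$ (isomorphic to $\mathbf{SE}(3)$); $\mathcal{HG}(3)$ is its underlying smooth manifold. Its Lie algebra $\mathfrak{hg}(3)$ consists of the matrices $(\boldsymbol{\omega},\boldsymbol{v})^{\wedge}=\begin{bmatrix}\boldsymbol{\omega}^{\wedge}&\boldsymbol{v}\\0&0\end{bmatrix}$, $\boldsymbol{\omega},\boldsymbol{v}\in\mathbb{R}^3$, where $\boldsymbol{\omega}^{\wedge}$ is the $3\times3$ skew-symmetric cross-product matrix; $(\cdot)^{\vee}:\mathfrak{hg}(3)\to\mathbb{R}^6$ is the inverse of $(\cdot)^{\wedge}$. $\mathrm{Ad}_B[\eta]=B\eta B^{-1}$ and $\mathbf{Ad}^{\vee}_B\boldsymbol{u}=(\mathrm{Ad}_B[\boldsymbol{u}^{\wedge}])^{\vee}$ for $\boldsymbol{u}\in\mathbb{R}^6$. The group product in $\mathbf{G_{DP}}$ is $XY=(B_XB_Y,\;\beta_X+\mathrm{Ad}_{B_X}[\beta_Y],\;c_X+c_Y)$, with inverse $X^{-1}=(B^{-1},-\mathrm{Ad}_{B^{-1}}[\beta],-c)$. A right group action is a smooth map with $\phi(I,\xi)=\xi$ and $\phi(X,\phi(Y,\xi))=\phi(YX,\xi)$; it is transitive if for all $\xi_1,\xi_2\in\mathcal{M}$ there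 is $Z$ with $\phi(Z,\xi_1)=\xi_2$. *)

theory Defs
  imports "HOL-Analysis.Analysis" "HOL-Algebra.Group"
begin

unbundle no cross3_syntax

section \<open>Smooth maps between submanifolds of Euclidean spaces\<close>

text \<open>
  \<open>k\<close>-fold continuous differentiability on an open set, via iterated directional
  derivatives of the Frechet derivative. Only meaningful for open \<open>U\<close>.
\<close>

fun C_k_on :: "nat \<Rightarrow> ('a::real_normed_vector \<Rightarrow> 'b::real_normed_vector) \<Rightarrow> 'a set \<Rightarrow> bool" where
  "C_k_on 0 f U \<longleftrightarrow> continuous_on U f"
| "C_k_on (Suc k) f U \<longleftrightarrow> (\<forall>x\<in>U. f differentiable (at x)) \<and>
     (\<forall>v. C_k_on k (\<lambda>x. frechet_derivative f (at x) v) U)"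

definition smooth_on :: "('a::euclidean_space \<Rightarrow> 'b::euclidean_space) \<Rightarrow> 'a set \<Rightarrow> bool" where
  "smooth_on f U \<longleftrightarrow> (\<forall>k. C_k_on k f U)"

text \<open>
  Smoothness of \<open>f : S \<rightarrow> T\<close> for subsets of Euclidean spaces: \<open>f\<close> locally extends to
  a smooth map on an open subset of the ambient space. When \<open>S\<close> and \<open>T\<close> are embedded
  submanifolds, this is smoothness for the submanifold structures.
\<close>

definition smooth_map :: "'a::euclidean_space set \<Rightarrow> 'b::euclidean_space set \<Rightarrow> ('a \<Rightarrow> 'b) \<Rightarrow> bool" where
  "smooth_map S T f \<longleftrightarrow> f \<in> S \<rightarrow> T \<and>
     (\<forall>x\<in>S. \<exists>U g. open U \<and> x \<in> U \<and> smooth_on g U \<and> (\<forall>y\<in>S \<inter> U. g y = f y))"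

section \<open>Right group actions\<close>

definition right_group_action ::
  "('g::euclidean_space, 'e) monoid_scheme \<Rightarrow> 'm::euclidean_space set \<Rightarrow> ('g \<times> 'm \<Rightarrow> 'm) \<Rightarrow> bool" where
  "right_group_action G M \<phi> \<longleftrightarrow>
     group G \<and>
     smooth_map (carrier G \<times> M) M \<phi> \<and>
     (\<forall>\<xi>\<in>M. \<phi> (\<one>\<^bsub>G\<^esub>, \<xi>) = \<xi>) \<and>
     (\<forall>X\<in>carrier G. \<forall>Y\<in>carrier G. \<forall>\<xi>\<in>M. \<phi> (X, \<phi> (Y, \<xi>)) = \<phi> (Y \<otimes>\<^bsub>G\<^esub> X, \<xi>))"

definition transitive_action ::
  "('g, 'e) monoid_scheme \<Rightarrow> 'm set \<Rightarrow> ('g \<times> 'm \<Rightarrow> 'm) \<Rightarrow> bool" where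
  "transitive_action G M \<phi> \<longleftrightarrow> (\<forall>\<xi>1\<in>M. \<forall>\<xi>2\<in>M. \<exists>Z\<in>carrier G. \<phi> (Z, \<xi>1) = \<xi>2)"

section \<open>The homogeneous Galilean group and its Lie algebra\<close>

text \<open>The block matrix with rows \<open>[A, a]\<close> and \<open>[0, d]\<close>.\<close>

definition block :: "real^3^3 \<Rightarrow> real^3 \<Rightarrow> real \<Rightarrow> real^4^4" where
  "block A a d = vector
     [vector [A$1$1, A$1$2, A$1$3, a$1],
      vector [A$2$1, A$2$2, A$2$3, a$2],
      vector [A$3$1, A$3$2, A$3$3, a$3],
      vector [0, 0, 0, d]]"

definition SO3 :: "(real^3^3) set" where
  "SO3 = {A. rotation_matrix A}"

definition HG3 :: "(real^4^4) set" where
  "HG3 = {block A a 1 | A a. A \<in> SO3}"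

definition skew3 :: "real^3 \<Rightarrow> real^3^3" where
  "skew3 \<omega> = matrix (cross3 \<omega>)"

text \<open>A vector of dimension 6 is read as the pair \<open>(\<omega>, v)\<close>, with \<open>\<omega>\<close> first.\<close>

definition wedge :: "real^6 \<Rightarrow> real^4^4" where
  "wedge u = block (skew3 (vector [u$1, u$2, u$3])) (vector [u$4, u$5, u$6]) 0"

definition hg3 :: "(real^4^4) set" where
  "hg3 = range wedge"

text \<open>Only meaningful on \<open>hg3\<close>, where it is the inverse of the injective map \<open>wedge\<close>.\<close>

definition vee :: "real^4^4 \<Rightarrow> real^6" where
  "vee = the_inv wedge"

definition Ad :: "real^4^4 \<Rightarrow> real^4^4 \<Rightarrow> real^4^4" where
  "Ad B \<eta> = B ** \<eta> ** matrix_inv B"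

definition Ad_vee :: "real^4^4 \<Rightarrow> real^6 \<Rightarrow> real^6" where
  "Ad_vee B u = vee (Ad B (wedge u))"

section \<open>The symmetry group, the state space and the action\<close>

definition G_DP :: "((real^4^4) \<times> (real^4^4) \<times> (real^3)) monoid" where
  "G_DP = \<lparr>carrier = HG3 \<times> hg3 \<times> UNIV,
     mult = (\<lambda>(B\<^sub>X, \<beta>\<^sub>X, c\<^sub>X) (B\<^sub>Y, \<beta>\<^sub>Y, c\<^sub>Y). (B\<^sub>X ** B\<^sub>Y, \<beta>\<^sub>X + Ad B\<^sub>X \<beta>\<^sub>Y, c\<^sub>X + c\<^sub>Y)),
     one = (mat 1, 0, 0)\<rparr>"

definition M_DP :: "((real^4^4) \<times> (real^6) \<times> (real^3)) set" where
  "M_DP = HG3 \<times> UNIV \<times> UNIV"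

definition \<phi>_DP ::
  "((real^4^4) \<times> (real^4^4) \<times> (real^3)) \<times> ((real^4^4) \<times> (real^6) \<times> (real^3)) \<Rightarrow>
   (real^4^4) \<times> (real^6) \<times> (real^3)" where
  "\<phi>_DP = (\<lambda>((B, \<beta>, c), (T, b, p)). (T ** B, Ad_vee (matrix_inv B) (b - vee \<beta>), p + c))"

end

theory Submission
  imports Defs
begin

text \<open>
  The action law reduces to the identity
  \<open>Ad\<^bsub>(CB)\<^sup>-\<^sup>1\<^esub> (\<gamma> + Ad\<^bsub>C\<^esub> \<beta>) = Ad\<^bsub>B\<^sup>-\<^sup>1\<^esub> (Ad\<^bsub>C\<^sup>-\<^sup>1\<^esub> \<gamma> + \<beta>)\<close>, and transitivity is witnessed by
  \<open>B = T\<^sup>-\<^sup>1 T'\<close>, \<open>\<beta> = (b - Ad\<^bsub>B\<^esub> b')\<^sup>\<and>\<close>, \<open>c = p' - p\<close>. For smoothness, the inverse of a matrix in HG(3) is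
  \<open>[A\<^sup>T, -A\<^sup>T a; 0, 1]\<close>, a polynomial in its entries, and the inverse of the hat map extends to a linear
  map on all matrices, so that the action is the restriction of a polynomial map of the whole ambient space.
\<close>

section \<open>Closure properties of smooth maps\<close>

lemma C_k_on_imp_continuous_on:
  assumes "C_k_on k f U"
  shows "continuous_on U f"
proof (cases k)
  case (Suc j)
  with assms show ?thesis
    by (auto intro!: continuous_at_imp_continuous_on differentiable_imp_continuous_within)
qed (use assms in simp)

text \<open>Needed for the product rule, where one factor of each summand stays undifferentiated and
  so has one order of smoothness to spare.\<close>

lemma C_k_on_Suc_imp: "C_k_on (Suc k) f U \<Longrightarrow> C_k_on k f U"
proof (induction k arbitrary: f)
  case 0
  then show ?case using C_k_on_imp_continuous_on by (metis C_k_on.simps(1))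
next
  case (Suc k)
  then show ?case by (metis C_k_on.simps(2))
qed

text \<open>As \<open>U\<close> is open, the derivative at a point of \<open>U\<close> depends only
  on the values in \<open>U\<close>, so agreement on \<open>U\<close> passes to all directional
  derivatives by induction.\<close>

lemma C_k_on_cong:
  assumes "open U" "\<And>x. x \<in> U \<Longrightarrow> f x = g x" "C_k_on k f U"
  shows "C_k_on k g U"
  using assms(2,3)
proof (induction k arbitrary: f g)
  case 0
  then show ?case by (simp cong: continuous_on_cong)
next
  case (Suc k)
  have diff: "g differentiable (at x)" if x: "x \<in> U" for x
  proof -
    obtain D where "(f has_derivative D) (at x)"
      using x Suc.prems(2) by (auto simp: differentiable_def)
    then have "(g has_derivative D) (at x)"
      using x Suc.prems(1) \<open>open U\<close> has_derivative_transform_within_open by metis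
    then show ?thesis by (rule differentiableI)
  qed
  have "frechet_derivative f (at x) = frechet_derivative g (at x)" if "x \<in> U" for x
    using that Suc.prems \<open>open U\<close> by (auto intro: frechet_derivative_transform_within_open)
  then have "C_k_on k (\<lambda>x. frechet_derivative g (at x) v) U" for v
    using Suc.prems by (auto intro: Suc.IH[of "\<lambda>x. frechet_derivative f (at x) v"])
  with diff show ?case by simp
qed

text \<open>Uniqueness of the Frechet derivative lets an explicit formula \<open>f'\<close> stand
  for the chosen \<open>frechet_derivative\<close>; this is how the inductions below
  differentiate.\<close>

lemma C_k_on_SucI:
  assumes "open U" "\<And>x. x \<in> U \<Longrightarrow> (f has_derivative f' x) (at x)"
    and "\<And>v. C_k_on k (\<lambda>x. f' x v) U"
  shows "C_k_on (Suc k) f U"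
proof -
  have "f' x v = frechet_derivative f (at x) v" if "x \<in> U" for x v
    using assms(2)[OF that] frechet_derivative_at by metis
  then have "C_k_on k (\<lambda>x. frechet_derivative f (at x) v) U" for v
    using C_k_on_cong[OF assms(1) _ assms(3)[of v]] by simp
  moreover have "\<forall>x\<in>U. f differentiable (at x)"
    using assms(2) differentiableI by blast
  ultimately show ?thesis by simp
qed

lemma C_k_on_SucD:
  assumes "C_k_on (Suc k) f U" "x \<in> U"
  shows "(f has_derivative frechet_derivative f (at x)) (at x)"
  using assms frechet_derivative_works by auto

lemma C_k_on_const:
  assumes "open U"
  shows "C_k_on k (\<lambda>x. c) U"
  using assms
  by (induction k arbitrary: c) simp_all

text \<open>The derivative of a bounded linear map is the map itself at every point, so each
  directional derivative is constant.\<close>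

lemma C_k_on_bounded_linear:
  assumes "open U" "bounded_linear f"
  shows "C_k_on k f U"
proof (cases k)
  case 0
  then show ?thesis using assms by (simp add: linear_continuous_on)
next
  case (Suc j)
  then show ?thesis
    using assms C_k_on_SucI[OF assms(1), where f = f and f' = "\<lambda>_. f"]
    by (simp add: bounded_linear_imp_has_derivative C_k_on_const del: C_k_on.simps)
qed

lemma C_k_on_add:
  assumes "open U" "C_k_on k f U" "C_k_on k g U"
  shows "C_k_on k (\<lambda>x. f x + g x) U"
  using assms(2,3)
proof (induction k arbitrary: f g)
  case 0
  then show ?case by (simp add: continuous_on_add)
next
  case (Suc k)
  show ?case
  proof (rule C_k_on_SucI[OF assms(1)])
    show "((\<lambda>x. f x + g x) has_derivative
        (\<lambda>v. frechet_derivative f (at x) v + frechet_derivative g (at x) v)) (at x)"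
      if "x \<in> U" for x
      using Suc.prems that by (blast intro: has_derivative_add C_k_on_SucD)
    show "C_k_on k (\<lambda>x. frechet_derivative f (at x) v + frechet_derivative g (at x) v) U" for v
      using Suc.prems by (auto intro: Suc.IH)
  qed
qed

text \<open>Induction with the Leibniz rule. It covers the matrix product and the matrix-vector
  product at once.\<close>

lemma C_k_on_bilinear:
  assumes "open U" "bounded_bilinear p" "C_k_on k f U" "C_k_on k g U"
  shows "C_k_on k (\<lambda>x. p (f x) (g x)) U"
  using assms(3,4)
proof (induction k arbitrary: f g)
  case 0
  then show ?case using bounded_bilinear.continuous_on[OF assms(2)] by simp
next
  case (Suc k)
  show ?case
  proof (rule C_k_on_SucI[OF assms(1)])
    show "((\<lambda>x. p (f x) (g x)) has_derivative (\<lambda>v. p (f x) (frechet_derivative g (at x) v) +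
        p (frechet_derivative f (at x) v) (g x))) (at x)"
      if "x \<in> U" for x
      using Suc.prems that by (blast intro: bounded_bilinear.FDERIV[OF assms(2)] C_k_on_SucD)
    show "C_k_on k (\<lambda>x. p (f x) (frechet_derivative g (at x) v) +
        p (frechet_derivative f (at x) v) (g x)) U" for v
    \<comment> \<open>Each summand pairs a derivative of order \<open>k\<close> with an original
      factor of order \<open>Suc k\<close>, which is lowered to \<open>k\<close> to fit the
      induction hypothesis.\<close>
    proof (rule C_k_on_add[OF assms(1)]; rule Suc.IH)
    qed (use Suc.prems C_k_on_Suc_imp in auto)
  qed
qed

lemma C_k_on_bounded_linear_compose:
  assumes "open U" "bounded_linear L" "C_k_on k f U"
  shows "C_k_on k (\<lambda>x. L (f x)) U"
  using assms(3)
proof (induction k arbitrary: f)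
  case 0
  then show ?case using bounded_linear.continuous_on[OF assms(2)] by simp
next
  case (Suc k)
  show ?case
  proof (rule C_k_on_SucI[OF assms(1)])
    show "((\<lambda>x. L (f x)) has_derivative (\<lambda>v. L (frechet_derivative f (at x) v))) (at x)"
      if "x \<in> U" for x
      using Suc.prems that by (blast intro: bounded_linear.has_derivative[OF assms(2)] C_k_on_SucD)
    show "C_k_on k (\<lambda>x. L (frechet_derivative f (at x) v)) U" for v
      using Suc.prems by (auto intro: Suc.IH)
  qed
qed

lemma smooth_on_const: "open U \<Longrightarrow> smooth_on (\<lambda>x. c) U"
  by (simp add: smooth_on_def C_k_on_const)

lemma smooth_on_linear: "open U \<Longrightarrow> linear f \<Longrightarrow> smooth_on f U"
  by (simp add: smooth_on_def C_k_on_bounded_linear linear_conv_bounded_linear)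

lemma smooth_on_add:
  "open U \<Longrightarrow> smooth_on f U \<Longrightarrow> smooth_on g U \<Longrightarrow> smooth_on (\<lambda>x. f x + g x) U"
  by (simp add: smooth_on_def C_k_on_add)

lemma smooth_on_linear_compose:
  "open U \<Longrightarrow> linear L \<Longrightarrow> smooth_on f U \<Longrightarrow> smooth_on (\<lambda>x. L (f x)) U"
  by (simp add: smooth_on_def C_k_on_bounded_linear_compose linear_conv_bounded_linear)

lemma smooth_on_bilinear:
  "open U \<Longrightarrow> bilinear p \<Longrightarrow> smooth_on f U \<Longrightarrow> smooth_on g U \<Longrightarrow> smooth_on (\<lambda>x. p (f x) (g x)) U"
  by (simp add: smooth_on_def C_k_on_bilinear bilinear_conv_bounded_bilinear)

text \<open>A pair is the sum of its images under the two linear coordinate embeddings, which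
  reduces pairing to sums and linear maps.\<close>

lemma smooth_on_Pair:
  assumes "open U" "smooth_on f U" "smooth_on g U"
  shows "smooth_on (\<lambda>x. (f x, g x)) U"
proof -
  have "smooth_on (\<lambda>x. (f x, 0) + (0, g x)) U"
    by (intro smooth_on_add smooth_on_linear_compose[of U "\<lambda>y. (y, 0)"]
        smooth_on_linear_compose[of U "\<lambda>y. (0, y)"] assms)
      (auto intro!: linearI)
  then show ?thesis by simp
qed

section \<open>Block matrices\<close>

lemma bilinear_matrix_mult: "bilinear ((**) :: real^'n^'m \<Rightarrow> real^'p^'n \<Rightarrow> real^'p^'m)"
  unfolding bilinear_def
  by (auto intro!: linearI simp: matrix_matrix_mult_def vec_eq_iff sum.distrib sum_distrib_left
      algebra_simps)

lemma bilinear_matrix_vector_mult: "bilinear ((*v) :: real^'n^'m \<Rightarrow> real^'n \<Rightarrow> real^'m)"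
  unfolding bilinear_def
  by (auto intro!: linearI simp: matrix_vector_mult_def vec_eq_iff sum.distrib sum_distrib_left
      algebra_simps)

lemma vector_4:
  fixes x y z w :: "'a::zero"
  shows "(vector [x, y, z, w] :: 'a^4) $ 1 = x" "(vector [x, y, z, w] :: 'a^4) $ 2 = y"
    "(vector [x, y, z, w] :: 'a^4) $ 3 = z" "(vector [x, y, z, w] :: 'a^4) $ 4 = w"
  by (simp_all add: vector_def)

lemma exhaust_6: "x = 1 \<or> x = 2 \<or> x = 3 \<or> x = 4 \<or> x = 5 \<or> x = 6" for x :: 6
proof (induct x)
  case (of_int z)
  \<comment> \<open>Representatives of the type \<open>6\<close> run from 0 to 5, and 0 is the
    element written 6.\<close>
  then have "z = 0 \<or> z = 1 \<or> z = 2 \<or> z = 3 \<or> z = 4 \<or> z = 5" by fastforce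
  then show ?case by auto
qed

lemma forall_6: "(\<forall>i::6. P i) \<longleftrightarrow> P 1 \<and> P 2 \<and> P 3 \<and> P 4 \<and> P 5 \<and> P 6"
  by (metis exhaust_6)

lemma vector_6:
  fixes a b c d e f :: "'a::zero"
  shows "(vector [a, b, c, d, e, f] :: 'a^6) $ 1 = a" "(vector [a, b, c, d, e, f] :: 'a^6) $ 2 = b"
    "(vector [a, b, c, d, e, f] :: 'a^6) $ 3 = c" "(vector [a, b, c, d, e, f] :: 'a^6) $ 4 = d"
    "(vector [a, b, c, d, e, f] :: 'a^6) $ 5 = e" "(vector [a, b, c, d, e, f] :: 'a^6) $ 6 = f"
  by (simp_all add: vector_def)

lemma block_mult:
  "block A a d ** block B b e = block (A ** B) (A *v b + e *\<^sub>R a) (d * e)"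
  by (simp add: block_def vec_eq_iff forall_4 vector_4 matrix_matrix_mult_def
      matrix_vector_mult_def sum_3 sum_4)

lemma block_add: "block A a d + block B b e = block (A + B) (a + b) (d + e)"
  by (simp add: block_def vec_eq_iff forall_4 vector_4)

lemma block_scaleR: "block (r *\<^sub>R A) (r *\<^sub>R a) (r * d) = r *\<^sub>R block A a d"
  by (simp add: block_def vec_eq_iff forall_4 vector_4)

lemma block_eq_iff: "block A a d = block B b e \<longleftrightarrow> A = B \<and> a = b \<and> d = e"
  by (auto simp: block_def vec_eq_iff forall_4 forall_3 vector_4)

lemma mat_1_block: "mat 1 = block (mat 1) 0 1"
  by (simp add: block_def mat_def vec_eq_iff forall_4 vector_4)

text \<open>Given on all matrices rather than on \<open>HG3\<close> alone, so that it is a linear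
  map of the ambient space.\<close>

definition rot_part :: "real^4^4 \<Rightarrow> real^3^3" where
  "rot_part M = vector
     [vector [M$1$1, M$1$2, M$1$3], vector [M$2$1, M$2$2, M$2$3], vector [M$3$1, M$3$2, M$3$3]]"

definition trans_part :: "real^4^4 \<Rightarrow> real^3" where
  "trans_part M = vector [M$1$4, M$2$4, M$3$4]"

lemma rot_part_block [simp]: "rot_part (block A a d) = A"
  by (simp add: rot_part_def block_def vec_eq_iff forall_3 vector_4)

lemma trans_part_block [simp]: "trans_part (block A a d) = a"
  by (simp add: trans_part_def block_def vec_eq_iff forall_3 vector_4)

lemma linear_rot_part: "linear rot_part"
  by (rule linearI) (simp_all add: rot_part_def vec_eq_iff forall_3)

lemma linear_trans_part: "linear trans_part"
  by (rule linearI) (simp_all add: trans_part_def vec_eq_iff forall_3)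

section \<open>The group HG(3) and its adjoint action\<close>

text \<open>\<open>matrix_inv\<close> is a choice of a two-sided inverse, and such inverses are
  unique: both sides equal \<open>B ** A ** matrix_inv A\<close>.\<close>

lemma matrix_inv_eqI:
  fixes A B :: "'a::semiring_1^'n^'n"
  assumes "A ** B = mat 1" "B ** A = mat 1"
  shows "matrix_inv A = B"
proof -
  have "A ** matrix_inv A = mat 1 \<and> matrix_inv A ** A = mat 1"
    unfolding matrix_inv_def by (rule someI[of _ B]) (use assms in simp)
  then show ?thesis
    by (metis assms(2) matrix_mul_assoc matrix_mul_lid matrix_mul_rid)
qed

text \<open>A polynomial formula on all matrices that agrees with \<open>matrix_inv\<close> on
  \<open>HG3\<close>; it serves as the smooth extension of inversion.\<close>

definition HG3_inv :: "real^4^4 \<Rightarrow> real^4^4" where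
  "HG3_inv B = block (transpose (rot_part B)) (- (transpose (rot_part B) *v trans_part B)) 1"

lemma HG3_inv:
  assumes "B \<in> HG3"
  shows "HG3_inv B \<in> HG3" "B ** HG3_inv B = mat 1" "HG3_inv B ** B = mat 1"
proof -
  obtain A a where B: "B = block A a 1" and A: "orthogonal_matrix A" "det A = 1"
    using assms by (auto simp: HG3_def SO3_def rotation_matrix_def)
  then have "rotation_matrix (transpose A)"
    by (simp add: rotation_matrix_def orthogonal_matrix_transpose)
  then show "HG3_inv B \<in> HG3"
    by (auto simp: HG3_def SO3_def HG3_inv_def B)
  have "A ** transpose A = mat 1" "transpose A ** A = mat 1"
    using A by (auto simp: orthogonal_matrix_def)
  \<comment> \<open>This is the term that cancels the translation part \<open>a\<close> in
    \<open>B ** HG3_inv B\<close>, once \<open>A ** transpose A\<close> is the identity.\<close>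
  moreover have "A *v - (transpose A *v a) = - ((A ** transpose A) *v a)"
    by (simp add: matrix_vector_mul_assoc bilinear_rneg[OF bilinear_matrix_vector_mult]
        del: transpose_matrix_vector)
  ultimately show "B ** HG3_inv B = mat 1" "HG3_inv B ** B = mat 1"
    by (simp_all add: B HG3_inv_def block_mult mat_1_block del: transpose_matrix_vector)
qed

lemma matrix_inv_HG3: "B \<in> HG3 \<Longrightarrow> matrix_inv B = HG3_inv B"
  by (simp add: HG3_inv matrix_inv_eqI)

lemma matrix_inv_matrix_inv_HG3: "B \<in> HG3 \<Longrightarrow> matrix_inv (matrix_inv B) = B"
  by (simp add: matrix_inv_HG3 HG3_inv(2,3) matrix_inv_eqI[of "HG3_inv B" B])

lemma HG3_matrix_inv:
  assumes "B \<in> HG3"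
  shows "matrix_inv B \<in> HG3" "B ** matrix_inv B = mat 1" "matrix_inv B ** B = mat 1"
  using HG3_inv assms matrix_inv_HG3 by auto

lemma HG3_one: "mat 1 \<in> HG3"
  unfolding HG3_def SO3_def mat_1_block
  by (auto simp: rotation_matrix_def orthogonal_matrix_id)

lemma HG3_mult: "B \<in> HG3 \<Longrightarrow> C \<in> HG3 \<Longrightarrow> B ** C \<in> HG3"
  unfolding HG3_def SO3_def
  by (auto simp: block_mult rotation_matrix_def orthogonal_matrix_mul det_mul block_eq_iff)

lemma matrix_inv_mult_HG3:
  assumes "B \<in> HG3" "C \<in> HG3"
  shows "matrix_inv (B ** C) = matrix_inv C ** matrix_inv B"
proof (rule matrix_inv_eqI)
  have "(B ** C) ** (matrix_inv C ** matrix_inv B) = B ** (C ** matrix_inv C) ** matrix_inv B"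
    by (simp only: matrix_mul_assoc)
  then show "(B ** C) ** (matrix_inv C ** matrix_inv B) = mat 1"
    using assms by (simp add: HG3_matrix_inv)
  have "(matrix_inv C ** matrix_inv B) ** (B ** C) = matrix_inv C ** (matrix_inv B ** B) ** C"
    by (simp only: matrix_mul_assoc)
  then show "(matrix_inv C ** matrix_inv B) ** (B ** C) = mat 1"
    using assms by (simp add: HG3_matrix_inv)
qed

lemma Ad_one [simp]: "Ad (mat 1) \<eta> = \<eta>"
  by (simp add: Ad_def matrix_inv_eqI[of "mat 1" "mat 1"])

lemma Ad_add: "Ad B (\<eta> + \<zeta>) = Ad B \<eta> + Ad B \<zeta>"
  by (simp add: Ad_def bilinear_ladd[OF bilinear_matrix_mult] bilinear_radd[OF bilinear_matrix_mult])

lemma Ad_mult: "B \<in> HG3 \<Longrightarrow> C \<in> HG3 \<Longrightarrow> Ad (B ** C) \<eta> = Ad B (Ad C \<eta>)"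
  by (simp add: Ad_def matrix_inv_mult_HG3 matrix_mul_assoc)

section \<open>The hat map, the Lie algebra hg(3) and its stability under Ad\<close>

lemma skew3_eq:
  "skew3 x = vector [vector [0, - x$3, x$2], vector [x$3, 0, - x$1], vector [- x$2, x$1, 0]]"
  by (simp add: skew3_def matrix_def cross3_def axis_def vec_eq_iff forall_3)

lemma linear_wedge: "linear wedge"
  by (rule linearI) (simp_all add: wedge_def block_def skew3_eq vec_eq_iff forall_4 vector_4)

lemma inj_wedge: "inj wedge"
  by (rule injI) (simp add: wedge_def block_def skew3_eq vec_eq_iff forall_4 vector_4 forall_6)

lemma vee_wedge [simp]: "vee (wedge u) = u"
  by (simp add: vee_def the_inv_f_f inj_wedge)

lemma wedge_in_hg3: "wedge u \<in> hg3"
  by (simp add: hg3_def)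

lemma wedge_vee: "\<eta> \<in> hg3 \<Longrightarrow> wedge (vee \<eta>) = \<eta>"
  by (auto simp: hg3_def)

text \<open>A description by skew-symmetry instead of coordinates, in which invariance under
  conjugation becomes visible.\<close>

lemma hg3_eq: "hg3 = {block S v 0 | S v. transpose S = - S}"
proof (intro equalityI subsetI)
  fix \<eta> assume "\<eta> \<in> hg3"
  then show "\<eta> \<in> {block S v 0 | S v. transpose S = - S}"
    by (force simp: hg3_def wedge_def skew3_eq transpose_def vec_eq_iff forall_3)
next
  fix \<eta> assume "\<eta> \<in> {block S v 0 | S v. transpose S = - S}"
  then obtain S v where \<eta>: "\<eta> = block S v 0" and "transpose S = - S"
    by blast
  have S: "S$j$i = - S$i$j" for i j
  proof -
    have "transpose S $ i $ j = (- S) $ i $ j" by (simp only: \<open>transpose S = - S\<close>)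
    then show ?thesis by (simp add: transpose_def)
  qed
  have "S$1$1 = 0" "S$2$2 = 0" "S$3$3 = 0"
    using S[of 1 1] S[of 2 2] S[of 3 3] by simp_all
  \<comment> \<open>The first three coordinates are the entries where \<open>skew3\<close> carries
    the components of its argument with positive sign.\<close>
  then have "\<eta> = wedge (vector [S$3$2, S$1$3, S$2$1, v$1, v$2, v$3])"
    by (simp add: \<eta> wedge_def block_def skew3_eq vec_eq_iff forall_4 vector_4 vector_6
        S[of 1 2] S[of 2 3] S[of 3 1])
  then show "\<eta> \<in> hg3" by (simp add: hg3_def)
qed

text \<open>On \<open>HG3\<close> the inverse has rotation block \<open>transpose A\<close>, so
  conjugation turns \<open>S\<close> into \<open>A ** S ** transpose A\<close>, again skew, and
  keeps the corner entry 0.\<close>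

lemma Ad_hg3:
  assumes "B \<in> HG3" "\<eta> \<in> hg3"
  shows "Ad B \<eta> \<in> hg3"
proof -
  obtain A a where B: "B = block A a 1" using assms by (auto simp: HG3_def)
  obtain S v where \<eta>: "\<eta> = block S v 0" and S: "transpose S = - S"
    using assms by (auto simp: hg3_eq)
  have "transpose (A ** S ** transpose A) = - (A ** S ** transpose A)"
    by (simp add: matrix_transpose_mul S matrix_mul_assoc bilinear_lneg[OF bilinear_matrix_mult]
        bilinear_rneg[OF bilinear_matrix_mult])
  then show ?thesis
    using assms(1) by (auto simp: Ad_def matrix_inv_HG3 HG3_inv_def block_mult hg3_eq block_eq_iff B \<eta>)
qed

lemma hg3_zero: "0 \<in> hg3"
  by (metis hg3_def linear_0 linear_wedge rangeI)

lemma hg3_add: "\<eta> \<in> hg3 \<Longrightarrow> \<zeta> \<in> hg3 \<Longrightarrow> \<eta> + \<zeta> \<in> hg3"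
  by (auto simp: hg3_def simp flip: linear_add[OF linear_wedge])

lemma hg3_minus: "\<eta> \<in> hg3 \<Longrightarrow> - \<eta> \<in> hg3"
  by (auto simp: hg3_def simp flip: linear_neg[OF linear_wedge])

lemma vee_add: "\<eta> \<in> hg3 \<Longrightarrow> \<zeta> \<in> hg3 \<Longrightarrow> vee (\<eta> + \<zeta>) = vee \<eta> + vee \<zeta>"
  by (auto simp: hg3_def simp flip: linear_add[OF linear_wedge])

lemma wedge_Ad_vee: "B \<in> HG3 \<Longrightarrow> wedge (Ad_vee B u) = Ad B (wedge u)"
  by (simp add: Ad_vee_def wedge_vee Ad_hg3 wedge_in_hg3)

lemma Ad_vee_one [simp]: "Ad_vee (mat 1) u = u"
  by (simp add: Ad_vee_def)

text \<open>As \<open>wedge\<close> is injective, it suffices to compare the matrices, where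
  bilinearity of the product applies.\<close>

lemma Ad_vee_diff: "B \<in> HG3 \<Longrightarrow> Ad_vee B (u - w) = Ad_vee B u - Ad_vee B w"
  by (rule injD[OF inj_wedge])
    (simp add: wedge_Ad_vee linear_diff[OF linear_wedge] Ad_def
      bilinear_lsub[OF bilinear_matrix_mult] bilinear_rsub[OF bilinear_matrix_mult])

lemma Ad_vee_mult: "B \<in> HG3 \<Longrightarrow> C \<in> HG3 \<Longrightarrow> Ad_vee (B ** C) u = Ad_vee B (Ad_vee C u)"
  by (rule injD[OF inj_wedge]) (simp add: wedge_Ad_vee Ad_mult HG3_mult)

lemma Ad_vee_vee: "\<eta> \<in> hg3 \<Longrightarrow> Ad_vee B (vee \<eta>) = vee (Ad B \<eta>)"
  by (simp add: Ad_vee_def wedge_vee)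

section \<open>The action\<close>

text \<open>Associativity of the semidirect product rests on Ad being multiplicative in the group
  element and additive in the algebra element. A left inverse suffices for
  \<open>groupI\<close>.\<close>

lemma group_G_DP: "group G_DP"
proof (rule groupI)
  fix X Y assume "X \<in> carrier G_DP" "Y \<in> carrier G_DP"
  then show "X \<otimes>\<^bsub>G_DP\<^esub> Y \<in> carrier G_DP"
    by (auto simp: G_DP_def HG3_mult hg3_add Ad_hg3)
next
  show "\<one>\<^bsub>G_DP\<^esub> \<in> carrier G_DP"
    by (simp add: G_DP_def HG3_one hg3_zero)
next
  fix X Y Z assume "X \<in> carrier G_DP" "Y \<in> carrier G_DP" "Z \<in> carrier G_DP"
  then show "X \<otimes>\<^bsub>G_DP\<^esub> Y \<otimes>\<^bsub>G_DP\<^esub> Z = X \<otimes>\<^bsub>G_DP\<^esub> (Y \<otimes>\<^bsub>G_DP\<^esub> Z)"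
    by (auto simp: G_DP_def matrix_mul_assoc Ad_mult Ad_add add.assoc)
next
  fix X assume "X \<in> carrier G_DP"
  then show "\<one>\<^bsub>G_DP\<^esub> \<otimes>\<^bsub>G_DP\<^esub> X = X"
    by (auto simp: G_DP_def)
next
  fix X assume "X \<in> carrier G_DP"
  then obtain B \<beta> c where X: "X = (B, \<beta>, c)" "B \<in> HG3" "\<beta> \<in> hg3"
    by (auto simp: G_DP_def)
  then have "(matrix_inv B, - Ad (matrix_inv B) \<beta>, - c) \<in> carrier G_DP"
    by (simp add: G_DP_def HG3_matrix_inv Ad_hg3 hg3_minus)
  moreover have "(matrix_inv B, - Ad (matrix_inv B) \<beta>, - c) \<otimes>\<^bsub>G_DP\<^esub> X = \<one>\<^bsub>G_DP\<^esub>"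
    using X by (simp add: G_DP_def HG3_matrix_inv)
  ultimately show "\<exists>Y\<in>carrier G_DP. Y \<otimes>\<^bsub>G_DP\<^esub> X = \<one>\<^bsub>G_DP\<^esub>" by blast
qed

section \<open>Smoothness of the action\<close>

lemma smooth_on_HG3_inv:
  assumes "open U" "smooth_on f U"
  shows "smooth_on (\<lambda>x. HG3_inv (f x)) U"
proof -
  \<comment> \<open>The inverse is affine in the pair of \<open>transpose A\<close> and
    \<open>transpose A *v a\<close>: \<open>L\<close> is its linear part, with corner 0, and the
    constant \<open>block 0 0 1\<close> restores the corner 1.\<close>
  define L :: "(real^3^3) \<times> (real^3) \<Rightarrow> real^4^4"
    where "L = (\<lambda>(A, a). block A (- a) 0)"
  have "linear L"
  proof (rule linearI)
    show "L (x + y) = L x + L y" for x y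
      by (cases x; cases y) (simp add: L_def block_add)
    show "L (r *\<^sub>R x) = r *\<^sub>R L x" for r x
      using block_scaleR[of r "fst x" "- snd x" 0] by (cases x) (simp add: L_def)
  qed
  have "linear (transpose :: real^3^3 \<Rightarrow> _)"
    by (rule linearI) (simp_all add: transpose_def vec_eq_iff)
  then have "smooth_on (\<lambda>x. transpose (rot_part (f x))) U"
    by (rule smooth_on_linear_compose[OF assms(1) _
        smooth_on_linear_compose[OF assms(1) linear_rot_part assms(2)]])
  moreover have "smooth_on (\<lambda>x. trans_part (f x)) U"
    by (rule smooth_on_linear_compose[OF assms(1) linear_trans_part assms(2)])
  ultimately have "smooth_on (\<lambda>x. L (transpose (rot_part (f x)),
      transpose (rot_part (f x)) *v trans_part (f x)) + block 0 0 1) U"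
    using \<open>linear L\<close> assms(1)
    by (intro smooth_on_add smooth_on_const smooth_on_linear_compose[of U L] smooth_on_Pair
        smooth_on_bilinear[OF _ bilinear_matrix_vector_mult])
  then show ?thesis
    by (simp add: L_def HG3_inv_def block_add)
qed

lemma smooth_map_\<phi>_DP: "smooth_map (carrier G_DP \<times> M_DP) M_DP \<phi>_DP"
proof -
  \<comment> \<open>\<open>vee\<close> is controlled only on \<open>hg3\<close>; a linear left
    inverse \<open>h\<close> of \<open>wedge\<close> agrees with it there and is smooth on all
    matrices.\<close>
  obtain h :: "real^4^4 \<Rightarrow> real^6" where "linear h" and h: "h \<circ> wedge = id"
    using linear_injective_left_inverse[OF linear_wedge inj_wedge] by blast
  have vee: "vee \<eta> = h \<eta>" if "\<eta> \<in> hg3" for \<eta>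
    using that h by (auto simp: hg3_def fun_eq_iff)
  \<comment> \<open>The global extension of \<open>\<phi>_DP\<close>: \<open>h\<close> replaces
    \<open>vee\<close>, \<open>HG3_inv\<close> replaces the inverse of \<open>B\<close>, and
    \<open>B\<close> itself replaces the inverse of that inverse.\<close>
  define g :: "((real^4^4) \<times> (real^4^4) \<times> (real^3)) \<times> ((real^4^4) \<times> (real^6) \<times> (real^3)) \<Rightarrow>
      (real^4^4) \<times> (real^6) \<times> (real^3)"
    where "g z = (fst (snd z) ** fst (fst z),
      h (HG3_inv (fst (fst z)) ** wedge (fst (snd (snd z)) - h (fst (snd (fst z)))) ** fst (fst z)),
      snd (snd (snd z)) + snd (snd (fst z)))" for z
  have B: "smooth_on (\<lambda>z. fst (fst z)) UNIV"
    by (rule smooth_on_linear) (auto intro!: linearI)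
  have T: "smooth_on (\<lambda>z. fst (snd z)) UNIV"
    by (rule smooth_on_linear) (auto intro!: linearI)
  have W: "smooth_on (\<lambda>z. wedge (fst (snd (snd z)) - h (fst (snd (fst z))))) UNIV"
    by (rule smooth_on_linear)
      (auto intro!: linearI simp: linear_add[OF \<open>linear h\<close>] linear_add[OF linear_wedge]
        linear_diff[OF linear_wedge] linear_cmul[OF \<open>linear h\<close>] linear_cmul[OF linear_wedge]
        scaleR_diff_right)
  have C: "smooth_on (\<lambda>z. snd (snd (snd z)) + snd (snd (fst z))) UNIV"
    by (rule smooth_on_linear) (auto intro!: linearI simp: scaleR_add_right)
  have "smooth_on g UNIV"
    unfolding g_def
    by (intro smooth_on_Pair smooth_on_linear_compose[of _ h] smooth_on_bilinear[OF _ bilinear_matrix_mult]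
        smooth_on_HG3_inv B T W C \<open>linear h\<close> open_UNIV)
  moreover have "g z = \<phi>_DP z" if "z \<in> carrier G_DP \<times> M_DP" for z
  proof -
    obtain B \<beta> c T b p where z: "z = ((B, \<beta>, c), (T, b, p))" by (metis surj_pair)
    then have mem: "B \<in> HG3" "\<beta> \<in> hg3" using that by (auto simp: G_DP_def)
    then have "HG3_inv B ** wedge u ** B = Ad (matrix_inv B) (wedge u)" for u
      by (simp only: Ad_def matrix_inv_matrix_inv_HG3 matrix_inv_HG3[symmetric])
    moreover have "h (Ad (matrix_inv B) (wedge u)) = Ad_vee (matrix_inv B) u" for u
      using mem by (simp add: Ad_vee_def vee Ad_hg3 HG3_matrix_inv wedge_in_hg3)
    ultimately show ?thesis
      using mem by (simp add: g_def z \<phi>_DP_def vee)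
  qed
  moreover have "\<phi>_DP \<in> carrier G_DP \<times> M_DP \<rightarrow> M_DP"
    by (auto simp: \<phi>_DP_def G_DP_def M_DP_def HG3_mult)
  ultimately show ?thesis
    unfolding smooth_map_def by (intro conjI ballI exI[of _ UNIV] exI[of _ g]) auto
qed

section \<open>Action laws and transitivity\<close>

lemma \<phi>_DP_one: "\<xi> \<in> M_DP \<Longrightarrow> \<phi>_DP (\<one>\<^bsub>G_DP\<^esub>, \<xi>) = \<xi>"
  \<comment> \<open>With \<open>wedge 0 = 0\<close> this yields \<open>vee 0 = 0\<close>, so the
    identity element shifts \<open>b\<close> by nothing.\<close>
  using vee_wedge[of 0]
  by (auto simp: \<phi>_DP_def G_DP_def matrix_inv_eqI[of "mat 1" "mat 1"] linear_0[OF linear_wedge])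

lemma \<phi>_DP_mult:
  assumes "X \<in> carrier G_DP" "Y \<in> carrier G_DP" "\<xi> \<in> M_DP"
  shows "\<phi>_DP (X, \<phi>_DP (Y, \<xi>)) = \<phi>_DP (Y \<otimes>\<^bsub>G_DP\<^esub> X, \<xi>)"
proof -
  obtain B \<beta> c C \<gamma> d T b p
    where eq: "X = (B, \<beta>, c)" "Y = (C, \<gamma>, d)" "\<xi> = (T, b, p)" by (metis surj_pair)
  with assms have mem: "B \<in> HG3" "\<beta> \<in> hg3" "C \<in> HG3" "\<gamma> \<in> hg3"
    by (auto simp: G_DP_def)
  then have inv: "matrix_inv B \<in> HG3" "matrix_inv C \<in> HG3"
    by (auto simp: HG3_matrix_inv)
  \<comment> \<open>The twist by \<open>Ad C\<close> in the product of \<open>Y\<close> and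
    \<open>X\<close> is undone by the inverse of \<open>C\<close>, with which \<open>Y\<close> has
    already acted.\<close>
  have "Ad_vee (matrix_inv C) (vee (Ad C \<beta>)) = vee \<beta>"
    using mem inv by (simp add: Ad_vee_vee Ad_hg3 HG3_matrix_inv flip: Ad_mult)
  then have "Ad_vee (matrix_inv B) (Ad_vee (matrix_inv C) (b - vee \<gamma>) - vee \<beta>) =
      Ad_vee (matrix_inv (C ** B)) (b - vee (\<gamma> + Ad C \<beta>))"
    using mem inv
    \<comment> \<open>The subtracted sum is first regrouped into successive differences; only then
      is \<open>Ad_vee\<close> distributed over them.\<close>
    by (simp add: matrix_inv_mult_HG3 Ad_vee_mult vee_add Ad_hg3 flip: diff_diff_eq)
      (simp add: Ad_vee_diff)
  then show ?thesis
    by (simp add: eq \<phi>_DP_def G_DP_def matrix_mul_assoc add_ac)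
qed

lemma transitive_\<phi>_DP: "transitive_action G_DP M_DP \<phi>_DP"
  unfolding transitive_action_def
proof (intro ballI)
  fix \<xi>1 \<xi>2 assume "\<xi>1 \<in> M_DP" "\<xi>2 \<in> M_DP"
  then obtain T b p T' b' p'
    where eq: "\<xi>1 = (T, b, p)" "\<xi>2 = (T', b', p')" and T: "T \<in> HG3" "T' \<in> HG3"
    by (auto simp: M_DP_def)
  define B where "B = matrix_inv T ** T'"
  have B: "B \<in> HG3" using T by (simp add: B_def HG3_mult HG3_matrix_inv)
  \<comment> \<open>Obtained by solving \<open>Ad_vee (matrix_inv B) (b - vee \<beta>) = b'\<close>
    for \<open>\<beta>\<close>.\<close>
  define \<beta> where "\<beta> = wedge (b - Ad_vee B b')"
  have "Ad_vee (matrix_inv B) (b - vee \<beta>) = b'"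
    using B by (simp add: \<beta>_def HG3_matrix_inv flip: Ad_vee_mult)
  moreover have "T ** B = T'"
    using T by (simp add: B_def matrix_mul_assoc HG3_matrix_inv)
  ultimately have "\<phi>_DP ((B, \<beta>, p' - p), \<xi>1) = \<xi>2"
    by (simp add: \<phi>_DP_def eq)
  moreover have "(B, \<beta>, p' - p) \<in> carrier G_DP"
    using B by (simp add: G_DP_def \<beta>_def wedge_in_hg3)
  ultimately show "\<exists>Z\<in>carrier G_DP. \<phi>_DP (Z, \<xi>1) = \<xi>2" by blast
qed

theorem lemma5p6p1:
  shows "right_group_action G_DP M_DP \<phi>_DP \<and> transitive_action G_DP M_DP \<phi>_DP"
  unfolding right_group_action_def
  using group_G_DP smooth_map_\<phi>_DP \<phi>_DP_one \<phi>_DP_mult transitive_\<phi>_DP by blast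

end
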